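(* Let $\alpha := \limsup_{N \to +\infty} \frac{\log(\#\mathfrak{E}_N)}{N}$ and fix $\varepsilon > 0$. For almost all $\tau \in \mathbb{R}$ (with respect to Lebesgue measure) there exists $N_0 = N_0(\tau,\varepsilon)$ such that $$\mathfrak{m}_N(\tau) > \exp\left(-(\alpha+\varepsilon) N\right)$$ for all integers $N \geq N_0$.
   Context: For each integer $N \geq 1$: $\mathfrak{E}_N := \left\{\sum_{n=1}^N \frac{t_n}{n} : t_1,\dots,t_N \in \{0,1\}\right\}$, and $\#\mathfrak{E}_N$ is its cardinality; $\mathfrak{S}_N := \left\{\sum_{n=1}^N \frac{s_n}{n} : s_1,\dots,s_N \in \{-1,+1\}\right\}$; and, for $\tau \in \mathbb{R}$, $\mathfrak{m}_N(\tau) := \min\{|\tau-\sigma| : \sigma \in \mathfrak{S}_N\}$. *)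

theory Defs
  imports "HOL-Analysis.Analysis"
begin

definition E_set :: "nat \<Rightarrow> real set" where
  "E_set N = {(\<Sum>n = 1..N. t n / real n) | t :: nat \<Rightarrow> real. \<forall>n\<in>{1..N}. t n \<in> {0, 1}}"

definition S_set :: "nat \<Rightarrow> real set" where
  "S_set N = {(\<Sum>n = 1..N. s n / real n) | s :: nat \<Rightarrow> real. \<forall>n\<in>{1..N}. s n \<in> {-1, 1}}"

definition m_dist :: "nat \<Rightarrow> real \<Rightarrow> real" where
  "m_dist N \<tau> = Min {\<bar>\<tau> - \<sigma>\<bar> | \<sigma>. \<sigma> \<in> S_set N}"

text \<open>
  The limsup is finite because \<open>card (E_set N) \<le> 2 ^ N\<close>, so converting it from the extended
  reals to \<^typ>\<open>real\<close> loses nothing (lemma \<open>ereal_alpha\<close> below). The term for \<open>N = 0\<close> is irrelevant to the limsup.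
\<close>
definition alpha :: real where
  "alpha = real_of_ereal (limsup (\<lambda>N. ereal (ln (real (card (E_set N))) / real N)))"

lemma coeff_sums_image:
  fixes a b :: real
  shows "{(\<Sum>n = 1..N. t n / real n) | t :: nat \<Rightarrow> real. \<forall>n\<in>{1..N}. t n \<in> {a, b}}
       = (\<lambda>t. \<Sum>n = 1..N. t n / real n) ` ({1..N} \<rightarrow>\<^sub>E {a, b})"
proof -
  have "\<exists>u\<in>{1..N} \<rightarrow>\<^sub>E {a, b}. (\<Sum>n = 1..N. t n / real n) = (\<Sum>n = 1..N. u n / real n)"
    if "\<forall>n\<in>{1..N}. t n \<in> {a, b}" for t :: "nat \<Rightarrow> real"
    using that by (intro bexI[of _ "restrict t {1..N}"] sum.cong) auto
  then show ?thesis
    by (fastforce simp: PiE_iff image_iff)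
qed

lemma finite_E_set: "finite (E_set N)"
  unfolding E_set_def coeff_sums_image by (intro finite_imageI finite_PiE) auto

lemma E_set_nonempty: "E_set N \<noteq> {}"
  unfolding E_set_def by (auto intro: exI[of _ "\<lambda>_. 0"])

lemma card_E_set_le: "card (E_set N) \<le> 2 ^ N"
proof -
  have "card (E_set N) \<le> card ({1..N} \<rightarrow>\<^sub>E {0::real, 1})"
    unfolding E_set_def coeff_sums_image by (intro card_image_le finite_PiE) auto
  then show ?thesis by (simp add: card_PiE numeral_2_eq_2)
qed

lemma finite_S_set: "finite (S_set N)"
  unfolding S_set_def coeff_sums_image by (intro finite_imageI finite_PiE) auto

lemma S_set_nonempty: "S_set N \<noteq> {}"
  unfolding S_set_def by (auto intro: exI[of _ "\<lambda>_. 1"])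

lemma ereal_alpha: "ereal alpha = limsup (\<lambda>N. ereal (ln (real (card (E_set N))) / real N))"
proof -
  let ?f = "\<lambda>N. ln (real (card (E_set N))) / real N"
  have pos: "card (E_set N) \<ge> 1" for N
    using finite_E_set[of N] E_set_nonempty[of N] by (simp add: Suc_le_eq card_gt_0_iff)
  have f0: "0 \<le> ?f N" for N
    using pos[of N] by (intro divide_nonneg_nonneg ln_ge_zero) auto
  have f1: "?f N \<le> ln 2" for N
  proof (cases "N = 0")
    case False
    have "real (card (E_set N)) \<le> 2 ^ N"
      using card_E_set_le[of N] by (metis of_nat_le_iff of_nat_numeral of_nat_power)
    then have "ln (real (card (E_set N))) \<le> ln (2 ^ N)"
      using pos[of N] by (subst ln_le_cancel_iff) auto
    also have "\<dots> = real N * ln 2" by (simp add: ln_realpow)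
    finally show ?thesis using False by (simp add: field_simps)
  qed simp
  have "limsup (\<lambda>N. ereal (?f N)) \<le> ereal (ln 2)"
    by (intro Limsup_bounded always_eventually allI) (use f1 in simp)
  moreover have "ereal 0 \<le> limsup (\<lambda>N. ereal (?f N))"
    by (intro le_Limsup always_eventually allI) (use f0 in simp_all)
  ultimately have "\<bar>limsup (\<lambda>N. ereal (?f N))\<bar> \<noteq> \<infinity>" by auto
  then show ?thesis unfolding alpha_def by (simp add: ereal_real)
qed

end

theory Submission imports Defs begin

text \<open>
  The substitution \<open>s = 2 t - 1\<close> shows that the set of signed sums is an affine image of the
  set of subset sums, so it has at most \<open>exp ((\<alpha> + \<epsilon> / 2) N)\<close> elements for large \<open>N\<close>. The
  points within \<open>exp (- (\<alpha> + \<epsilon>) N)\<close> of it therefore form a set of measure at most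
  \<open>2 exp (- \<epsilon> N / 2)\<close>, which is summable, and the Borel--Cantelli lemma applies.
\<close>

lemma S_set_subset_affine_image_E_set:
  "S_set N \<subseteq> (\<lambda>x. 2 * x - (\<Sum>n = 1..N. 1 / real n)) ` E_set N"
proof
  fix x assume "x \<in> S_set N"
  then obtain s where x: "x = (\<Sum>n = 1..N. s n / real n)" and s: "\<forall>n\<in>{1..N}. s n \<in> {-1, 1}"
    unfolding S_set_def by blast
  let ?t = "\<lambda>n. (s n + 1) / 2"
  have "x = 2 * (\<Sum>n = 1..N. ?t n / real n) - (\<Sum>n = 1..N. 1 / real n)"
    unfolding x by (simp add: sum_distrib_left add_divide_distrib flip: sum_subtractf)
  moreover have "(\<Sum>n = 1..N. ?t n / real n) \<in> E_set N"
    unfolding E_set_def using s by (force intro: exI[of _ ?t])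
  ultimately show "x \<in> (\<lambda>x. 2 * x - (\<Sum>n = 1..N. 1 / real n)) ` E_set N"
    by blast
qed

lemma card_S_set_le_card_E_set: "card (S_set N) \<le> card (E_set N)"
  using S_set_subset_affine_image_E_set finite_E_set by (rule surj_card_le[rotated])

text \<open>The \<open>Min\<close> ranges over a finite nonempty set, so it is attained and a strict
  lower bound may be tested at each signed sum.\<close>

lemma less_m_dist_iff: "r < m_dist N \<tau> \<longleftrightarrow> (\<forall>\<sigma>\<in>S_set N. r < \<bar>\<tau> - \<sigma>\<bar>)"
proof -
  have "{\<bar>\<tau> - \<sigma>\<bar> | \<sigma>. \<sigma> \<in> S_set N} = (\<lambda>\<sigma>. \<bar>\<tau> - \<sigma>\<bar>) ` S_set N"
    by auto
  then show ?thesis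
    unfolding m_dist_def using finite_S_set[of N] S_set_nonempty[of N] by simp
qed

lemma eventually_card_E_set_le:
  assumes "\<delta> > 0"
  shows "eventually (\<lambda>N. real (card (E_set N)) \<le> exp ((alpha + \<delta>) * real N)) sequentially"
proof -
  have "limsup (\<lambda>N. ereal (ln (real (card (E_set N))) / real N)) < ereal (alpha + \<delta>)"
    using assms by (simp flip: ereal_alpha)
  \<comment> \<open>The condition \<open>N > 0\<close> allows the division by \<open>N\<close> to be
    cleared.\<close>
  from Limsup_lessD[OF this] eventually_gt_at_top[of 0] show ?thesis
  proof eventually_elim
    case (elim N)
    have "card (E_set N) > 0"
      using finite_E_set E_set_nonempty by (simp add: card_gt_0_iff)
    moreover from elim have "ln (real (card (E_set N))) \<le> (alpha + \<delta>) * real N"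
      by (simp add: field_simps)
    ultimately show ?case
      by (metis exp_le_cancel_iff exp_ln of_nat_0_less_iff)
  qed
qed

text \<open>Union bound: each ball is an interval of length \<open>2 * r\<close>.\<close>

lemma measure_cball_union_le:
  fixes S :: "real set"
  assumes "finite S" "r \<ge> 0"
  shows "measure lebesgue (\<Union>\<sigma>\<in>S. cball \<sigma> r) \<le> real (card S) * (2 * r)"
proof -
  have "measure lebesgue (\<Union>\<sigma>\<in>S. cball \<sigma> r) \<le> (\<Sum>\<sigma>\<in>S. measure lebesgue (cball \<sigma> r))"
    using assms by (intro measure_UNION_le) auto
  also have "\<dots> = real (card S) * (2 * r)"
    using assms by (simp add: cball_eq_atLeastAtMost)
  finally show ?thesis .
qed

theorem lemma1p1:
  fixes \<epsilon> :: real
  assumes "\<epsilon> > 0"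
  shows "AE \<tau> in lebesgue. \<exists>N0. \<forall>N\<ge>N0. m_dist N \<tau> > exp (- (alpha + \<epsilon>) * real N)"
proof -
  define r where "r N = exp (- (alpha + \<epsilon>) * real N)" for N
  define A where "A N = (\<Union>\<sigma>\<in>S_set N. cball \<sigma> (r N))" for N
  \<comment> \<open>Borel--Cantelli asks for finite measure as well as measurability.\<close>
  have A: "A N \<in> lmeasurable" for N
    unfolding A_def by (intro fmeasurable.finite_UN finite_S_set) auto
  \<comment> \<open>Half of \<epsilon> pays for the cardinality bound; the other half remains as
    geometric decay once alpha cancels in the exponents.\<close>
  have "eventually (\<lambda>N. norm (measure lebesgue (A N)) \<le> 2 * exp (- (\<epsilon> / 2)) ^ N) sequentially"
    using eventually_card_E_set_le[OF half_gt_zero[OF assms]]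
  proof eventually_elim
    case (elim N)
    have "measure lebesgue (A N) \<le> real (card (S_set N)) * (2 * r N)"
      unfolding A_def by (intro measure_cball_union_le finite_S_set) (simp add: r_def)
    also have "\<dots> \<le> exp ((alpha + \<epsilon> / 2) * real N) * (2 * r N)"
      using elim card_S_set_le_card_E_set[of N] by (intro mult_right_mono) (auto simp: r_def)
    also have "\<dots> = 2 * exp (- (\<epsilon> / 2)) ^ N"
      by (simp add: r_def algebra_simps flip: exp_add exp_of_nat_mult)
    finally show ?case by simp
  qed
  moreover have "summable (\<lambda>N. 2 * exp (- (\<epsilon> / 2)) ^ N)"
    using assms by (intro summable_mult summable_geometric) simp
  ultimately have "summable (\<lambda>N. measure lebesgue (A N))"
    by (rule summable_comparison_test_ev)
  then have "AE \<tau> in lebesgue. eventually (\<lambda>N. \<tau> \<in> space lebesgue - A N) sequentially"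
    using A by (intro borel_cantelli_AE1) (simp_all add: fmeasurable_def del: emeasure_completion)
  then show ?thesis
  proof eventually_elim
    case (elim \<tau>)
    \<comment> \<open>Because the balls are closed, lying outside all of them gives the strict
      inequality.\<close>
    have "m_dist N \<tau> > r N" if "\<tau> \<notin> A N" for N
      using that by (auto simp: less_m_dist_iff A_def dist_real_def abs_minus_commute not_le)
    with elim show ?case
      unfolding r_def eventually_sequentially by blast
  qed
qed

end
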